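(* Let $A\in\mathbb{R}^{n\times n}$, $B\in\mathbb{R}^{n\times m}$, $C\in\mathbb{R}^{m\times n}$, $D\in\mathbb{R}^{m\times m}$, $F\in\mathbb{R}^{r\times n}$, $G\in\mathbb{R}^{r\times m}$, and for each $t\in\mathbb{N}$ let $\Psi_t:\mathbb{R}^r\to\mathcal{P}(\mathbb{R}^m)$ be a set-valued mapping. Consider the implicit Lur'e system $$x(t+1)=Ax(t)+Bu(t),\qquad 0\in Cx(t)+Du(t)+\Psi_t(Fx(t)+Gu(t)),$$ and assume that the inclusion $0\in Cx+Du+\Psi_t(Fx+Gu)$ admits a unique solution $u$ for each $x\in\mathbb{R}^n$ and $t\in\mathbb{N}$. Suppose that $\Psi_t$ admits $M_1,\dots,M_p\in\mathbb{R}^{(r+m)\times(r+m)}$ as incremental multiplier matrices (IMMs), for every $t\in\mathbb{N}$. Let $P\in\mathbb{R}^{n\times n}$ be positive definite and $\eta\in(0,1)$. If there exist nonnegative scalars $\lambda_1,\dots,\lambda_p$ satisfying $$\begin{bmatrix}A^\top PA-\eta^2P&A^\top PB\\ B^\top PA&B^\top PB\end{bmatrix}+\mathtt{sol}\Big(\sum_{i=1}^p\lambda_iM_i\Big)\preceq0,\qquad \mathtt{sol}(M):=\begin{bmatrix}F&G\\ -C&-D\end{bmatrix}^\top M\begin{bmatrix}F&G\\ -C&-D\end{bmatrix},$$ then the closed-loop system is strongly contracting with respect to the norm $\|\cdot\|_P$ with factor $\eta$.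
   Context: $\mathcal{P}(S)$ is the power set of $S$. A set-valued mapping $\Psi:\mathbb{R}^{a}\to\mathcal{P}(\mathbb{R}^{b})$ admits the symmetric matrix $M\in\mathbb{R}^{(a+b)\times(a+b)}$ as an incremental multiplier matrix (IMM) if, for all $z^{(1)},z^{(2)}\in\mathbb{R}^a$ and all $g^{(1)}\in\Psi(z^{(1)})$, $g^{(2)}\in\Psi(z^{(2)})$, $$\begin{bmatrix}z^{(1)}-z^{(2)}\\ g^{(1)}-g^{(2)}\end{bmatrix}^\top M\begin{bmatrix}z^{(1)}-z^{(2)}\\ g^{(1)}-g^{(2)}\end{bmatrix}\ge0.$$ A system $x(t+1)=f_t(x(t))$ is strongly contracting with respect to $\|\cdot\|_P$ ($\|v\|_P=\sqrt{v^\top Pv}$, $P$ symmetric positive definite) with factor $\eta\in(0,1)$ if any two trajectories satisfy $\|x^{(1)}(t+1)-x^{(2)}(t+1)\|_P\le\eta\|x^{(1)}(t)-x^{(2)}(t)\|_P$ for all $t\in\mathbb{N}$. The closed loop is $x(t+1)=Ax(t)+Bu_t^\ast(x(t))$, where $u_t^\ast(x)$ is the unique solution of the inclusion. *)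

theory Defs
  imports "HOL-Analysis.Analysis"
begin

text \<open>Block vectors and block matrices are indexed by the disjoint sum of the index types,
  so that the space of dimension \<open>a + b\<close> is rendered as \<^typ>\<open>real ^ ('a + 'b)\<close>.\<close>

definition block_vec :: "'c ^ 'a \<Rightarrow> 'c ^ 'b \<Rightarrow> 'c ^ ('a + 'b)" where
  "block_vec v w = (\<chi> i. case i of Inl a \<Rightarrow> v $ a | Inr b \<Rightarrow> w $ b)"

definition block_mat ::
  "'c ^ 'a ^ 'd \<Rightarrow> 'c ^ 'b ^ 'd \<Rightarrow> 'c ^ 'a ^ 'e \<Rightarrow> 'c ^ 'b ^ 'e \<Rightarrow> 'c ^ ('a + 'b) ^ ('d + 'e)" where
  "block_mat X Y Z W =
     (\<chi> i. case i of Inl d \<Rightarrow> block_vec (X $ d) (Y $ d) | Inr e \<Rightarrow> block_vec (Z $ e) (W $ e))"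

definition symmetric_matrix :: "real ^ 'n ^ 'n \<Rightarrow> bool" where
  "symmetric_matrix M \<longleftrightarrow> transpose M = M"

definition positive_definite :: "real ^ 'n ^ 'n \<Rightarrow> bool" where
  "positive_definite M \<longleftrightarrow> symmetric_matrix M \<and> (\<forall>v. v \<noteq> 0 \<longrightarrow> v \<bullet> (M *v v) > 0)"

definition negative_semidefinite :: "real ^ 'n ^ 'n \<Rightarrow> bool" where
  "negative_semidefinite M \<longleftrightarrow> symmetric_matrix M \<and> (\<forall>v. v \<bullet> (M *v v) \<le> 0)"

definition weighted_norm :: "real ^ 'n ^ 'n \<Rightarrow> real ^ 'n \<Rightarrow> real" where
  "weighted_norm P v = sqrt (v \<bullet> (P *v v))"

definition incremental_multiplier_matrix ::
  "(real ^ 'a \<Rightarrow> (real ^ 'b) set) \<Rightarrow> real ^ ('a + 'b) ^ ('a + 'b) \<Rightarrow> bool" where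
  "incremental_multiplier_matrix \<Psi> M \<longleftrightarrow> symmetric_matrix M \<and>
     (\<forall>z1 z2. \<forall>g1 \<in> \<Psi> z1. \<forall>g2 \<in> \<Psi> z2.
        block_vec (z1 - z2) (g1 - g2) \<bullet> (M *v block_vec (z1 - z2) (g1 - g2)) \<ge> 0)"

definition trajectory :: "(nat \<Rightarrow> 'a \<Rightarrow> 'a) \<Rightarrow> (nat \<Rightarrow> 'a) \<Rightarrow> bool" where
  "trajectory f x \<longleftrightarrow> (\<forall>t. x (Suc t) = f t (x t))"

definition strongly_contracting ::
  "(nat \<Rightarrow> real ^ 'n \<Rightarrow> real ^ 'n) \<Rightarrow> real ^ 'n ^ 'n \<Rightarrow> real \<Rightarrow> bool" where
  "strongly_contracting f P \<eta> \<longleftrightarrow> positive_definite P \<and> 0 < \<eta> \<and> \<eta> < 1 \<and>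
     (\<forall>x1 x2. trajectory f x1 \<longrightarrow> trajectory f x2 \<longrightarrow>
        (\<forall>t. weighted_norm P (x1 (Suc t) - x2 (Suc t)) \<le> \<eta> * weighted_norm P (x1 t - x2 t)))"

definition lure_inclusion ::
  "real ^ 'n ^ 'm \<Rightarrow> real ^ 'm ^ 'm \<Rightarrow> real ^ 'n ^ 'r \<Rightarrow> real ^ 'm ^ 'r \<Rightarrow>
   (real ^ 'r \<Rightarrow> (real ^ 'm) set) \<Rightarrow> real ^ 'n \<Rightarrow> real ^ 'm \<Rightarrow> bool" where
  "lure_inclusion C D F G \<Psi> x u \<longleftrightarrow> 0 \<in> (+) (C *v x + D *v u) ` \<Psi> (F *v x + G *v u)"

text \<open>The input is given by a definite description, hence it is only meaningful when the
  inclusion has a unique solution.\<close>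

definition lure_input ::
  "real ^ 'n ^ 'm \<Rightarrow> real ^ 'm ^ 'm \<Rightarrow> real ^ 'n ^ 'r \<Rightarrow> real ^ 'm ^ 'r \<Rightarrow>
   (real ^ 'r \<Rightarrow> (real ^ 'm) set) \<Rightarrow> real ^ 'n \<Rightarrow> real ^ 'm" where
  "lure_input C D F G \<Psi> x = (THE u. lure_inclusion C D F G \<Psi> x u)"

definition lure_closed_loop ::
  "real ^ 'n ^ 'n \<Rightarrow> real ^ 'm ^ 'n \<Rightarrow> real ^ 'n ^ 'm \<Rightarrow> real ^ 'm ^ 'm \<Rightarrow>
   real ^ 'n ^ 'r \<Rightarrow> real ^ 'm ^ 'r \<Rightarrow> (nat \<Rightarrow> real ^ 'r \<Rightarrow> (real ^ 'm) set) \<Rightarrow>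
   nat \<Rightarrow> real ^ 'n \<Rightarrow> real ^ 'n" where
  "lure_closed_loop A B C D F G \<Psi> t x = A *v x + B *v lure_input C D F G (\<Psi> t) x"

definition sol ::
  "real ^ 'n ^ 'm \<Rightarrow> real ^ 'm ^ 'm \<Rightarrow> real ^ 'n ^ 'r \<Rightarrow> real ^ 'm ^ 'r \<Rightarrow>
   real ^ ('r + 'm) ^ ('r + 'm) \<Rightarrow> real ^ ('n + 'm) ^ ('n + 'm)" where
  "sol C D F G M =
     transpose (block_mat F G (- C) (- D)) ** M ** block_mat F G (- C) (- D)"

end

theory Submission
  imports Defs
begin

text \<open>
  The claim is the incremental S-procedure. Take two states and their inputs, and let
  \<open>\<delta>x\<close>, \<open>\<delta>u\<close> be the differences. Since an input solves the inclusion, the vector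
  \<open>- (C x + D u)\<close> is an element of the set \<open>\<Psi>\<^sub>t (F x + G u)\<close>, so the block matrix with rows
  \<open>(F, G)\<close> and \<open>(- C, - D)\<close> sends \<open>(\<delta>x, \<delta>u)\<close> to an increment of the graph of \<open>\<Psi>\<^sub>t\<close>. The
  quadratic form of \<open>sol M\<close> at \<open>(\<delta>x, \<delta>u)\<close> is therefore the multiplier form of \<open>M\<close> at a graph
  increment, and it is nonnegative when \<open>M\<close> is a multiplier matrix; the conic combinations of
  multiplier matrices are again such matrices.

  The quadratic form of the other summand of the matrix inequality, at the same vector, is the
  dissipation \<open>\<parallel>A \<delta>x + B \<delta>u\<parallel>\<^sub>P\<^sup>2 - \<eta>\<^sup>2 \<parallel>\<delta>x\<parallel>\<^sub>P\<^sup>2\<close>. The two forms add up to at most zero and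
  the multiplier form is nonnegative, so the dissipation is nonpositive, and a square root
  gives the contraction in one step. The facts that carry this argument are
  \<open>lyapunov_block_quadratic_form\<close>, \<open>sol_quadratic_form\<close> and
  \<open>incremental_multiplier_matrix_conic_sum\<close>.
\<close>

lemma sum_UNIV_Plus:
  "sum f (UNIV :: ('a::finite + 'b::finite) set) = (\<Sum>a\<in>UNIV. f (Inl a)) + (\<Sum>b\<in>UNIV. f (Inr b))"
  by (simp flip: UNIV_Plus_UNIV add: sum.Plus)

lemma inner_block_vec:
  fixes a c :: "real ^ 'a" and b d :: "real ^ 'b"
  shows "block_vec a b \<bullet> block_vec c d = a \<bullet> c + b \<bullet> d"
  by (simp add: inner_vec_def sum_UNIV_Plus block_vec_def)

lemma block_mat_mult_block_vec:
  fixes v :: "real ^ 'a" and w :: "real ^ 'b"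
  shows "block_mat X Y Z W *v block_vec v w = block_vec (X *v v + Y *v w) (Z *v v + W *v w)"
  by (simp add: vec_eq_iff matrix_vector_mult_def sum_UNIV_Plus block_vec_def block_mat_def
      split: sum.split)

lemma inner_transpose_mult:
  fixes A :: "real ^ 'a ^ 'b"
  shows "x \<bullet> (transpose A *v y) = (A *v x) \<bullet> y"
  by (metis dot_lmul_matrix inner_commute transpose_matrix_vector)

lemma inner_congruence:
  fixes A :: "real ^ 'a ^ 'b" and B :: "real ^ 'c ^ 'd"
  shows "x \<bullet> ((transpose A ** M ** B) *v y) = (A *v x) \<bullet> (M *v (B *v y))"
  by (simp only: inner_transpose_mult matrix_vector_mul_assoc[symmetric])

lemma sum_matrix_vector_mult:
  fixes M :: "'i \<Rightarrow> real ^ 'a ^ 'b"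
  shows "(\<Sum>i\<in>I. M i) *v v = (\<Sum>i\<in>I. M i *v v)"
  by (induction I rule: infinite_finite_induct) (simp_all add: matrix_vector_mult_add_rdistrib)

lemma symmetric_matrix_conic_sum:
  assumes "\<And>i. i \<in> I \<Longrightarrow> symmetric_matrix (M i)"
  shows "symmetric_matrix (\<Sum>i\<in>I. l i *\<^sub>R M i)"
  using assms by (simp add: symmetric_matrix_def transpose_def vec_eq_iff)

text \<open>
  The multiplier inequality is linear in the matrix, so the multiplier matrices of a mapping
  form a convex cone. This reduces the family of multipliers to a single one.
\<close>

lemma incremental_multiplier_matrix_conic_sum:
  assumes "\<And>i. i \<in> I \<Longrightarrow> incremental_multiplier_matrix \<Psi> (M i)"
    and "\<And>i. i \<in> I \<Longrightarrow> 0 \<le> l i"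
  shows "incremental_multiplier_matrix \<Psi> (\<Sum>i\<in>I. l i *\<^sub>R M i)"
  using assms
  by (auto simp: incremental_multiplier_matrix_def symmetric_matrix_conic_sum
      sum_matrix_vector_mult inner_sum_right scaleR_matrix_vector_assoc[symmetric]
      intro!: sum_nonneg mult_nonneg_nonneg)

lemma lure_inclusion_iff:
  fixes D :: "real ^ 'm ^ 'm"
  shows "lure_inclusion C D F G \<Psi> x u \<longleftrightarrow> - (C *v x + D *v u) \<in> \<Psi> (F *v x + G *v u)"
proof -
  have "0 = y + g \<longleftrightarrow> g = - y" for y g :: "real ^ 'm"
    by (subst eq_neg_iff_add_eq_0) (auto simp: add.commute)
  then show ?thesis
    unfolding lure_inclusion_def image_iff by simp
qed

lemma lure_inclusion_lure_input:
  assumes "\<exists>!u. lure_inclusion C D F G \<Psi> x u"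
  shows "lure_inclusion C D F G \<Psi> x (lure_input C D F G \<Psi> x)"
  unfolding lure_input_def using assms by (rule theI')

lemma lyapunov_block_quadratic_form:
  fixes A :: "real ^ 'n ^ 'n" and B :: "real ^ 'm ^ 'n" and P :: "real ^ 'n ^ 'n"
  shows "block_vec v w \<bullet>
      (block_mat (transpose A ** P ** A - c *\<^sub>R P) (transpose A ** P ** B)
         (transpose B ** P ** A) (transpose B ** P ** B) *v block_vec v w)
    = (A *v v + B *v w) \<bullet> (P *v (A *v v + B *v w)) - c * (v \<bullet> (P *v v))"
  by (simp add: block_mat_mult_block_vec inner_block_vec inner_congruence algebra_simps
      matrix_vector_mult_diff_rdistrib matrix_vector_right_distrib inner_add_left inner_add_right
      inner_diff_right scaleR_matrix_vector_assoc[symmetric])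

lemma sol_quadratic_form:
  "block_vec v w \<bullet> (sol C D F G M *v block_vec v w) =
    block_vec (F *v v + G *v w) (- (C *v v + D *v w)) \<bullet>
      (M *v block_vec (F *v v + G *v w) (- (C *v v + D *v w)))"
proof -
  have "(- C) *v v + (- D) *v w = - (C *v v + D *v w)"
    by (simp add: vec_eq_iff matrix_vector_mult_def sum_negf)
  then show ?thesis
    by (simp add: sol_def inner_congruence block_mat_mult_block_vec)
qed

text \<open>
  The lower block row of the matrix in \<open>sol\<close> carries a minus sign because the inclusion puts
  \<open>- (C x + D u)\<close>, and not \<open>C x + D u\<close>, into the graph. With this sign a pair of solutions gives
  a graph increment, where the multiplier inequality applies.
\<close>

lemma sol_quadratic_form_nonneg:
  assumes "incremental_multiplier_matrix \<Psi> M"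
    and "lure_inclusion C D F G \<Psi> x1 u1" and "lure_inclusion C D F G \<Psi> x2 u2"
  shows "0 \<le> block_vec (x1 - x2) (u1 - u2) \<bullet> (sol C D F G M *v block_vec (x1 - x2) (u1 - u2))"
proof -
  let ?z = "\<lambda>x u. F *v x + G *v u" and ?g = "\<lambda>x u. - (C *v x + D *v u)"
  have "?z (x1 - x2) (u1 - u2) = ?z x1 u1 - ?z x2 u2"
    and "?g (x1 - x2) (u1 - u2) = ?g x1 u1 - ?g x2 u2"
    by (simp_all add: matrix_vector_mult_diff_distrib)
  then show ?thesis
    using assms unfolding sol_quadratic_form
    by (simp only: incremental_multiplier_matrix_def lure_inclusion_iff)
qed

lemma weighted_norm_le_mult:
  assumes "w \<bullet> (P *v w) \<le> c\<^sup>2 * (v \<bullet> (P *v v))" and "0 \<le> c"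
  shows "weighted_norm P w \<le> c * weighted_norm P v"
proof -
  have "weighted_norm P w \<le> sqrt (c\<^sup>2 * (v \<bullet> (P *v v)))"
    using assms(1) by (simp add: weighted_norm_def)
  also have "\<dots> = c * weighted_norm P v"
    using assms(2) by (simp add: weighted_norm_def real_sqrt_mult)
  finally show ?thesis .
qed

theorem corollary1:
  fixes A :: "real ^ 'n ^ 'n" and B :: "real ^ 'm ^ 'n"
    and C :: "real ^ 'n ^ 'm" and D :: "real ^ 'm ^ 'm"
    and F :: "real ^ 'n ^ 'r" and G :: "real ^ 'm ^ 'r"
    and \<Psi> :: "nat \<Rightarrow> real ^ 'r \<Rightarrow> (real ^ 'm) set"
    and p :: nat and M :: "nat \<Rightarrow> real ^ ('r + 'm) ^ ('r + 'm)"
    and P :: "real ^ 'n ^ 'n" and \<eta> :: real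
  assumes "\<And>t x. \<exists>!u. lure_inclusion C D F G (\<Psi> t) x u"
    and "\<And>t i. i \<in> {1..p} \<Longrightarrow> incremental_multiplier_matrix (\<Psi> t) (M i)"
    and "positive_definite P"
    and "0 < \<eta>" and "\<eta> < 1"
    and "\<exists>l :: nat \<Rightarrow> real. (\<forall>i\<in>{1..p}. 0 \<le> l i) \<and>
           negative_semidefinite
             (block_mat
                (transpose A ** P ** A - \<eta>\<^sup>2 *\<^sub>R P) (transpose A ** P ** B)
                (transpose B ** P ** A)              (transpose B ** P ** B)
              + sol C D F G (\<Sum>i=1..p. l i *\<^sub>R M i))"
  shows "strongly_contracting (lure_closed_loop A B C D F G \<Psi>) P \<eta>"
proof -
  obtain l :: "nat \<Rightarrow> real" where l: "\<And>i. i \<in> {1..p} \<Longrightarrow> 0 \<le> l i"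
    and lmi: "negative_semidefinite
             (block_mat
                (transpose A ** P ** A - \<eta>\<^sup>2 *\<^sub>R P) (transpose A ** P ** B)
                (transpose B ** P ** A)              (transpose B ** P ** B)
              + sol C D F G (\<Sum>i=1..p. l i *\<^sub>R M i))"
    using assms(6) by blast
  let ?f = "lure_closed_loop A B C D F G \<Psi>"
  have step: "weighted_norm P (?f t x1 - ?f t x2) \<le> \<eta> * weighted_norm P (x1 - x2)" for t x1 x2
  proof (rule weighted_norm_le_mult)
    let ?u = "lure_input C D F G (\<Psi> t)"
    let ?v = "x1 - x2" and ?w = "?u x1 - ?u x2"
    have incr: "?f t x1 - ?f t x2 = A *v ?v + B *v ?w"
      by (simp add: lure_closed_loop_def matrix_vector_mult_diff_distrib)
    have solves: "lure_inclusion C D F G (\<Psi> t) x (?u x)" for x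
      by (rule lure_inclusion_lure_input, rule assms(1))
    have "incremental_multiplier_matrix (\<Psi> t) (\<Sum>i=1..p. l i *\<^sub>R M i)"
      using assms(2) l by (rule incremental_multiplier_matrix_conic_sum)
    then have "0 \<le> block_vec ?v ?w \<bullet>
        (sol C D F G (\<Sum>i=1..p. l i *\<^sub>R M i) *v block_vec ?v ?w)"
      using solves solves by (rule sol_quadratic_form_nonneg)
    moreover have "(A *v ?v + B *v ?w) \<bullet> (P *v (A *v ?v + B *v ?w)) - \<eta>\<^sup>2 * (?v \<bullet> (P *v ?v))
        + block_vec ?v ?w \<bullet> (sol C D F G (\<Sum>i=1..p. l i *\<^sub>R M i) *v block_vec ?v ?w) \<le> 0"
      using lmi[unfolded negative_semidefinite_def, THEN conjunct2, rule_format,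
          of "block_vec ?v ?w"]
      by (simp only: inner_add_right lyapunov_block_quadratic_form
          matrix_vector_mult_add_rdistrib)
    ultimately show "(?f t x1 - ?f t x2) \<bullet> (P *v (?f t x1 - ?f t x2))
        \<le> \<eta>\<^sup>2 * (?v \<bullet> (P *v ?v))"
      unfolding incr by linarith
  qed (use assms(4) in simp)
  show ?thesis
    using assms(3-5) step by (simp add: strongly_contracting_def trajectory_def)
qed

end
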